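(* Let $k$ be a field, $R=k[x_1,\dots,x_n]$, $d\ge1$, let $F$ be a free $R$-module with basis $e_1,\dots,e_n$, and let $\psi:F\to R$ be given by $\psi(e_i)=x_i$, so that $\operatorname{im}\psi=(x_1,\dots,x_n)$. Let $\phi_0=\mathrm{id}:R\to R$ and, for $m\ge1$, let $\phi_m:\mathrm{EK}_m\to L(\psi,d)_m$ be the $R$-linear map $T\mapsto(-1)^{m-1}(T\backslash j_d)_{j_d}$, that is, on basis elements $$\phi_m\big([i_1,\dots,i_{m-1}\,|\,j_1,\dots,j_d]\big)=(-1)^{m-1}[j_d,i_1,\dots,i_{m-1}\,|\,j_1,\dots,j_{d-1}].$$ Then the maps $\phi_\bullet:\mathrm{EK}_\bullet\to L(\psi,d)$ form an isomorphism of complexes, extending the identity in homological degree $0$.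
   Context: **Tableau notation.** For a hook tableau $T=[i_1,\dots,i_a\,|\,j_1,\dots,j_b]$ ($i$'s the column part, $j$'s the row part), $T\backslash i_r$ and $T\backslash j_r$ delete the indicated entry, $T^s=[i_1,\dots,i_a|s,j_1,\dots,j_b]$, and $T_s=[s,i_1,\dots,i_a|j_1,\dots,j_b]$. **The complex $L(\psi,d)$.** Let $S_b$ be the $b$-th symmetric power of $F$, and let $\kappa_{a,b}:\bigwedge^aF\otimes S_b\to\bigwedge^{a-1}F\otimes S_{b+1}$ be comultiplication $\bigwedge^aF\to\bigwedge^{a-1}F\otimes F$ followed by multiplication $F\otimes S_b\to S_{b+1}$. Put $L^a_b=\ker\kappa_{a,b}$. The tableau $[i_0,\dots,i_a\,|\,j_1,\dots,j_{b-1}]$ (first column $i_0,\dots,i_a$ from top to bottom; rest of first row $j_1,\dots,j_{b-1}$) denotes the element $\kappa_{a+1,b-1}(e_{i_0}\wedge\cdots\wedge e_{i_a}\otimes e_{j_1}\cdots e_{j_{b-1}})\in L^a_b$. The semistandard tableaux ($i_0<\cdots<i_a$, $i_0\le j_1\le\cdots\le j_{b-1}$) form an $R$-basis of $L_b^a$. The complex $L(\psi,d)$ is $$0\to L_d^{n-1}\to\cdots\to L_d^1\to L_d^0\to R\to0,$$ with $L(\psi,d)_0=R$ and $L(\psi,d)_m=L_d^{m-1}$ for $m\ge1$. The maps $L_d^a\to L_d^{a-1}$, $a\ge1$, are induced by $\mathrm{Kos}^\psi\otimes1$ on $\bigwedge^aF\otimes S_d$, where $\mathrm{Kos}^\psi$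 is the Koszul differential of $\psi$; on tableaux this is $[i_0,\dots,i_a|j_1,\dots,j_{d-1}]\mapsto\sum_{r=0}^a(-1)^rx_{i_r}[i_0,\dots,\widehat{i_r},\dots,i_a|j_1,\dots,j_{d-1}]$. The map $L_d^0=S_dF\to R$ is $S_d(\psi)$: $[i_0|j_1,\dots,j_{d-1}]\mapsto x_{i_0}x_{j_1}\cdots x_{j_{d-1}}$. **The complex $\mathrm{EK}_\bullet$** (tableau form of the Eliahou–Kervaire resolution of $R/(x_1,\dots,x_n)^d$). $\mathrm{EK}_0=R$, and for $m\ge0$, $\mathrm{EK}_{m+1}$ is the free $R$-module on the symbols $T=[i_1,\dots,i_m|j_1,\dots,j_d]$ with $1\le i_1<\cdots<i_m<j_d\le n$ and $1\le j_1\le\cdots\le j_d$. (These are different objects from the tableaux in $L(\psi,d)$.) Symbols are alternating in the column part $i_1,\dots,i_m$ and symmetric in $j_1,\dots,j_d$; a symbol with an entry $i_\ell$ not smaller than the maximum of its row entries is $0$. For $m>0$, $$d(T)=\sum_{\ell=1}^m(-1)^\ell x_{i_\ell}(T\backslash i_\ell)-\sum_{\ell=1}^m(-1)^\ell x_{j_d}(T\backslash\{i_\ell,j_d\})^{i_\ell},$$ and $d([\,|j_1,\dots,j_d])=x_{j_1}\cdots x_{j_d}$ for $m=0$.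
   Formalization: The comultiplication splits off factors to the left with sign (-1)^r, so the Koszul-induced differential of L(ψ,d) on tableaux is minus the displayed formula; with the displayed sign the maps φ_m fail to commute (n=2, d=1, T=[1|2], char k≠2). *)

theory Defs
  imports Complex_Main "HOL-Library.Poly_Mapping" "HOL-Library.Multiset"
begin

section \<open>Polynomial rings and free modules\<close>

text \<open>
  The variables (and the basis vectors \<open>e\<^sub>1, \<dots>, e\<^sub>n\<close> of \<open>F\<close>) are indexed by a finite linearly
  ordered type \<open>'n\<close> with \<open>n = CARD('n)\<close>, in place of \<open>{1, \<dots>, n}\<close>.  Elements of
  \<open>k[x\<^sub>1, \<dots>, x\<^sub>n]\<close> are finitely supported functions from exponent vectors to \<open>k\<close>; the library
  multiplies them by convolution.
\<close>

type_synonym ('n, 'k) polyring = "('n \<Rightarrow>\<^sub>0 nat) \<Rightarrow>\<^sub>0 'k"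

definition polyvar :: "'n \<Rightarrow> ('n, 'k::comm_ring_1) polyring" where
  "polyvar i = Poly_Mapping.single (Poly_Mapping.single i 1) 1"

text \<open>
  The type \<open>'b \<Rightarrow>\<^sub>0 'r\<close> is the free \<open>'r\<close>-module on \<open>'b\<close>; the basis element belonging to \<open>b\<close> is
  \<open>Poly_Mapping.single b 1\<close>.
\<close>

definition smul :: "'r::comm_ring_1 \<Rightarrow> ('b \<Rightarrow>\<^sub>0 'r) \<Rightarrow> ('b \<Rightarrow>\<^sub>0 'r)" where
  "smul c v = Poly_Mapping.map ((*) c) v"

lemma lookup_smul: "Poly_Mapping.lookup (smul c v) b = c * Poly_Mapping.lookup v b"
  by (simp add: smul_def Poly_Mapping.map.rep_eq when_def)

lemma module_smul: "module (smul :: 'r::comm_ring_1 \<Rightarrow> ('b \<Rightarrow>\<^sub>0 'r) \<Rightarrow> ('b \<Rightarrow>\<^sub>0 'r))"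
  by unfold_locales
    (auto intro!: poly_mapping_eqI simp: lookup_smul lookup_add algebra_simps)

definition free_on :: "'b set \<Rightarrow> ('b \<Rightarrow>\<^sub>0 'r::comm_ring_1) set" where
  "free_on B = {v. Poly_Mapping.keys v \<subseteq> B}"

text \<open>Linear extension of a function given on the basis, with values in a free module or in the ring.\<close>

definition lin_ext :: "('b \<Rightarrow> ('c \<Rightarrow>\<^sub>0 'r::comm_ring_1)) \<Rightarrow> ('b \<Rightarrow>\<^sub>0 'r) \<Rightarrow> ('c \<Rightarrow>\<^sub>0 'r)" where
  "lin_ext f v = (\<Sum>b\<in>Poly_Mapping.keys v. smul (Poly_Mapping.lookup v b) (f b))"

definition lin_form :: "('b \<Rightarrow> 'r::comm_ring_1) \<Rightarrow> ('b \<Rightarrow>\<^sub>0 'r) \<Rightarrow> 'r" where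
  "lin_form f v = (\<Sum>b\<in>Poly_Mapping.keys v. Poly_Mapping.lookup v b * f b)"


section \<open>Complexes of modules ending in the ring, and their isomorphisms\<close>

definition linear_on ::
  "'u::ab_group_add set \<Rightarrow> ('r \<Rightarrow> 'u \<Rightarrow> 'u) \<Rightarrow> ('r \<Rightarrow> 'v \<Rightarrow> 'v) \<Rightarrow> ('u \<Rightarrow> 'v::ab_group_add) \<Rightarrow> bool" where
  "linear_on S s1 s2 f \<longleftrightarrow>
     (\<forall>x\<in>S. \<forall>y\<in>S. f (x + y) = f x + f y) \<and> (\<forall>c. \<forall>x\<in>S. f (s1 c x) = s2 c (f x))"

text \<open>
  A complex \<open>\<dots> \<rightarrow> C\<^sub>2 \<rightarrow> C\<^sub>1 \<rightarrow> R \<rightarrow> 0\<close> is given by submodules \<open>C m\<close> (\<open>m \<ge> 1\<close>) of one ambient free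
  module, a map \<open>\<delta>\<close> which restricts to \<open>C m \<rightarrow> C (m - 1)\<close> for all \<open>m \<ge> 2\<close>, and
  \<open>\<epsilon>\<close>, which restricts to the map from \<open>C 1\<close> to the degree 0 term \<open>R\<close>.  The value \<open>C 0\<close> is not used.
\<close>

definition is_complex ::
  "(nat \<Rightarrow> ('b \<Rightarrow>\<^sub>0 'r::comm_ring_1) set) \<Rightarrow> (('b \<Rightarrow>\<^sub>0 'r) \<Rightarrow> ('b \<Rightarrow>\<^sub>0 'r)) \<Rightarrow> (('b \<Rightarrow>\<^sub>0 'r) \<Rightarrow> 'r) \<Rightarrow> bool" where
  "is_complex C \<delta> \<epsilon> \<longleftrightarrow>
     (\<forall>m\<ge>1. module.subspace smul (C m)) \<and>
     (\<forall>m\<ge>2. linear_on (C m) smul smul \<delta> \<and> \<delta> ` C m \<subseteq> C (m - 1)) \<and>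
     linear_on (C 1) smul (*) \<epsilon> \<and>
     (\<forall>m\<ge>3. \<forall>v\<in>C m. \<delta> (\<delta> v) = 0) \<and>
     (\<forall>v\<in>C 2. \<epsilon> (\<delta> v) = 0)"

definition is_complex_iso ::
  "(nat \<Rightarrow> ('b \<Rightarrow>\<^sub>0 'r::comm_ring_1) set) \<Rightarrow> (('b \<Rightarrow>\<^sub>0 'r) \<Rightarrow> ('b \<Rightarrow>\<^sub>0 'r)) \<Rightarrow> (('b \<Rightarrow>\<^sub>0 'r) \<Rightarrow> 'r) \<Rightarrow>
   (nat \<Rightarrow> ('c \<Rightarrow>\<^sub>0 'r) set) \<Rightarrow> (('c \<Rightarrow>\<^sub>0 'r) \<Rightarrow> ('c \<Rightarrow>\<^sub>0 'r)) \<Rightarrow> (('c \<Rightarrow>\<^sub>0 'r) \<Rightarrow> 'r) \<Rightarrow>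
   ('r \<Rightarrow> 'r) \<Rightarrow> (nat \<Rightarrow> ('b \<Rightarrow>\<^sub>0 'r) \<Rightarrow> ('c \<Rightarrow>\<^sub>0 'r)) \<Rightarrow> bool" where
  "is_complex_iso C \<delta> \<epsilon> C' \<delta>' \<epsilon>' f0 f \<longleftrightarrow>
     is_complex C \<delta> \<epsilon> \<and> is_complex C' \<delta>' \<epsilon>' \<and>
     linear_on UNIV (*) (*) f0 \<and> bij f0 \<and>
     (\<forall>m\<ge>1. linear_on (C m) smul smul (f m) \<and> bij_betw (f m) (C m) (C' m)) \<and>
     (\<forall>v\<in>C 1. \<epsilon>' (f 1 v) = f0 (\<epsilon> v)) \<and>
     (\<forall>m\<ge>2. \<forall>v\<in>C m. \<delta>' (f m v) = f (m - 1) (\<delta> v))"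


section \<open>The complex \<open>L(\<psi>, d)\<close>\<close>

text \<open>
  \<open>F\<close> has the basis \<open>e\<^sub>i\<close>.  The basis element \<open>e\<^sub>i\<^sub>1 \<and> \<dots> \<and> e\<^sub>i\<^sub>a \<otimes> e\<^sub>j\<^sub>1 \<cdots> e\<^sub>j\<^sub>b\<close> with
  \<open>i\<^sub>1 < \<dots> < i\<^sub>a\<close> of \<open>\<And>\<^sup>aF \<otimes> S\<^sub>b\<close> is indexed by the pair consisting of the set
  \<open>{i\<^sub>1, \<dots>, i\<^sub>a}\<close> and the multiset of the \<open>j\<close>'s.
\<close>

type_synonym ('n, 'k) ext_sym = "('n set \<times> 'n multiset) \<Rightarrow>\<^sub>0 ('n, 'k) polyring"

definition ext_sym_part ::
  "nat \<Rightarrow> nat \<Rightarrow> ('n::{finite,linorder}, 'k::comm_ring_1) ext_sym set" where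
  "ext_sym_part a b = free_on {(A, M). card A = a \<and> size M = b}"

text \<open>The element \<open>e\<^sub>i\<^sub>1 \<and> \<dots> \<and> e\<^sub>i\<^sub>a \<otimes> e\<^sub>j\<^sub>1 \<cdots> e\<^sub>j\<^sub>b\<close> for an arbitrary list of \<open>i\<close>'s.\<close>

definition inversions :: "'n::linorder list \<Rightarrow> nat" where
  "inversions xs = card {(p, q). p < q \<and> q < length xs \<and> xs ! q < xs ! p}"

definition wedge_tensor ::
  "'n::{finite,linorder} list \<Rightarrow> 'n multiset \<Rightarrow> ('n, 'k::comm_ring_1) ext_sym" where
  "wedge_tensor xs M =
     (if distinct xs then Poly_Mapping.single (set xs, M) ((-1) ^ inversions xs) else 0)"

text \<open>The number of factors of \<open>e\<^sub>A\<close> standing to the left of \<open>e\<^sub>i\<close>.\<close>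

definition pos :: "'n::linorder set \<Rightarrow> 'n \<Rightarrow> nat" where
  "pos A i = card {j \<in> A. j < i}"

text \<open>
  Comultiplication, tensored with \<open>S\<^sub>b\<close>:
  \<open>e\<^sub>i\<^sub>0 \<and> \<dots> \<and> e\<^sub>i\<^sub>a \<mapsto> \<Sum>\<^sub>r (-1)\<^sup>r (e\<^sub>i\<^sub>0 \<and> \<dots> (omit e\<^sub>i\<^sub>r) \<dots> \<and> e\<^sub>i\<^sub>a) \<otimes> e\<^sub>i\<^sub>r\<close>, i.e. the factor
  to be split off is moved to the far left, as in the Koszul differential.  Moving it to the far
  right instead multiplies \<open>\<kappa>\<close> on \<open>\<And>\<^sup>a\<^sup>+\<^sup>1F\<close> by \<open>(-1)\<^sup>a\<close>; this does not
  change the kernels of \<open>\<kappa>\<close>, but it changes the sign of the tableaux.  With the convention used here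
  \<open>\<kappa>\<close> anticommutes with \<open>Kos\<^sup>\<psi> \<otimes> 1\<close>, so the induced differential is
  \<open>- \<Sum>\<^sub>r (-1)\<^sup>r x\<^sub>i\<^sub>r [i\<^sub>0, \<dots> (omit i\<^sub>r) \<dots>, i\<^sub>a | j\<^sub>1, \<dots>]\<close> on tableaux, and the maps \<open>\<phi>\<close> below, with
  their sign \<open>(-1)\<^sup>m\<^sup>-\<^sup>1\<close>, commute with the differentials; with the other convention
  they would do so only up to sign.
\<close>

definition comult ::
  "('n::{finite,linorder}, 'k::comm_ring_1) ext_sym \<Rightarrow>
   ('n set \<times> 'n \<times> 'n multiset) \<Rightarrow>\<^sub>0 ('n, 'k) polyring" where
  "comult = lin_ext (\<lambda>(A, M). \<Sum>i\<in>A. Poly_Mapping.single (A - {i}, i, M) ((-1) ^ pos A i))"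

definition sym_mult ::
  "(('n::{finite,linorder} set \<times> 'n \<times> 'n multiset) \<Rightarrow>\<^sub>0 ('n, 'k::comm_ring_1) polyring) \<Rightarrow>
   ('n, 'k) ext_sym" where
  "sym_mult = lin_ext (\<lambda>(A, i, M). Poly_Mapping.single (A, add_mset i M) 1)"

definition kappa ::
  "('n::{finite,linorder}, 'k::comm_ring_1) ext_sym \<Rightarrow> ('n, 'k) ext_sym" where
  "kappa v = sym_mult (comult v)"

definition Lker :: "nat \<Rightarrow> nat \<Rightarrow> ('n::{finite,linorder}, 'k::comm_ring_1) ext_sym set" where
  "Lker a b = {v \<in> ext_sym_part a b. kappa v = 0}"

text \<open>The tableau \<open>[i\<^sub>0, \<dots>, i\<^sub>a | j\<^sub>1, \<dots>, j\<^sub>b\<^sub>-\<^sub>1]\<close>, an element of \<open>Lker a b\<close>.\<close>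

definition L_tableau ::
  "'n::{finite,linorder} list \<Rightarrow> 'n multiset \<Rightarrow> ('n, 'k::comm_ring_1) ext_sym" where
  "L_tableau is J = kappa (wedge_tensor is J)"

definition L_complex ::
  "nat \<Rightarrow> nat \<Rightarrow> ('n::{finite,linorder}, 'k::comm_ring_1) ext_sym set" where
  "L_complex d m = Lker (m - 1) d"

text \<open>The linear map \<open>\<psi> : F \<rightarrow> R\<close> is given by its values \<open>\<psi>(e\<^sub>i)\<close>.  \<open>koszul \<psi>\<close> is \<open>Kos\<^sup>\<psi> \<otimes> 1\<close>.\<close>

definition koszul ::
  "('n::{finite,linorder} \<Rightarrow> ('n, 'k::comm_ring_1) polyring) \<Rightarrow>
   ('n, 'k) ext_sym \<Rightarrow> ('n, 'k) ext_sym" where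
  "koszul \<psi> = lin_ext (\<lambda>(A, M).
     \<Sum>i\<in>A. Poly_Mapping.single (A - {i}, M) ((-1) ^ pos A i * \<psi> i))"

text \<open>\<open>S\<^sub>d(\<psi>)\<close>; only its restriction to \<open>Lker 0 d = S\<^sub>dF\<close> matters.\<close>

definition sym_power ::
  "('n::{finite,linorder} \<Rightarrow> ('n, 'k::comm_ring_1) polyring) \<Rightarrow>
   ('n, 'k) ext_sym \<Rightarrow> ('n, 'k) polyring" where
  "sym_power \<psi> = lin_form (\<lambda>(A, M). if A = {} then (\<Prod>j\<in>#M. \<psi> j) else 0)"


section \<open>The complex \<open>EK\<close>\<close>

text \<open>
  The basis symbol \<open>[i\<^sub>1, \<dots>, i\<^sub>m | j\<^sub>1, \<dots>, j\<^sub>d]\<close> is indexed by the pair consisting of the set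
  of the \<open>i\<close>'s and the multiset of the \<open>j\<close>'s.  These index pairs are unrelated to those of
  \<open>\<And>F \<otimes> S\<close> above.
\<close>

type_synonym ('n, 'k) ek = "('n set \<times> 'n multiset) \<Rightarrow>\<^sub>0 ('n, 'k) polyring"

definition EK_complex ::
  "nat \<Rightarrow> nat \<Rightarrow> ('n::{finite,linorder}, 'k::comm_ring_1) ek set" where
  "EK_complex d m =
     free_on {(I, J). card I = m - 1 \<and> size J = d \<and> (\<forall>i\<in>I. i < Max_mset J)}"

text \<open>The symbol with an arbitrary list as column part: alternating, and zero unless all
  column entries are smaller than the maximum of the row entries.\<close>

definition EK_symbol ::
  "'n::{finite,linorder} list \<Rightarrow> 'n multiset \<Rightarrow> ('n, 'k::comm_ring_1) ek" where
  "EK_symbol is J =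
     (if distinct is \<and> (\<forall>i\<in>set is. i < Max_mset J)
      then Poly_Mapping.single (set is, J) ((-1) ^ inversions is) else 0)"

definition delete_nth :: "nat \<Rightarrow> 'a list \<Rightarrow> 'a list" where
  "delete_nth l xs = take l xs @ drop (Suc l) xs"

text \<open>The list index \<open>l\<close> starts at 0, hence the exponent \<open>Suc l\<close>; \<open>Max_mset J\<close> is \<open>j\<^sub>d\<close>.\<close>

definition EK_diff ::
  "('n::{finite,linorder}, 'k::comm_ring_1) ek \<Rightarrow> ('n, 'k) ek" where
  "EK_diff = lin_ext (\<lambda>(I, J). let is = sorted_list_of_set I; jd = Max_mset J in
     (\<Sum>l<length is. smul ((-1) ^ Suc l * polyvar (is ! l)) (EK_symbol (delete_nth l is) J)) -
     (\<Sum>l<length is. smul ((-1) ^ Suc l * polyvar jd)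
        (EK_symbol (delete_nth l is) (add_mset (is ! l) (J - {#jd#})))))"

text \<open>Only the restriction to \<open>EK_complex d 1\<close> matters, where the column part is empty.\<close>

definition EK_aug ::
  "('n::{finite,linorder}, 'k::comm_ring_1) ek \<Rightarrow> ('n, 'k) polyring" where
  "EK_aug = lin_form (\<lambda>(I, J). if I = {} then (\<Prod>j\<in>#J. polyvar j) else 0)"


section \<open>The comparison maps\<close>

definition phi ::
  "nat \<Rightarrow> ('n::{finite,linorder}, 'k::comm_ring_1) ek \<Rightarrow> ('n, 'k) ext_sym" where
  "phi m = lin_ext (\<lambda>(I, J). let jd = Max_mset J in
     smul ((-1) ^ (m - 1)) (L_tableau (jd # sorted_list_of_set I) (J - {#jd#})))"

end

theory Submission
  imports Defs
begin

text \<open>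
  Call a basis element \<open>e\<^sub>I \<otimes> e\<^sup>J\<close> of \<open>\<And>F \<otimes> SF\<close> an EK pair if every element of \<open>I\<close> is smaller than
  the maximum \<open>s\<close> of \<open>J\<close>.  Moving \<open>s\<close> from \<open>J\<close> to \<open>I\<close> (with sign \<open>(-1)\<^bsup>|I|\<^esup>\<close>), and sending the other
  basis elements to 0, is a contracting homotopy \<open>h\<close> of \<open>(\<And>F \<otimes> SF, \<kappa>)\<close> in positive symmetric degree.
  Let \<open>P\<close> be the projection onto the span of the EK pairs.  Then \<open>P \<kappa> h = 1\<close> on this span,
  \<open>\<kappa> h P = \<kappa> h = 1\<close> on the kernel of \<open>\<kappa>\<close>, and \<open>\<phi>\<^sub>m = (-1)\<^bsup>m-1\<^esup> \<kappa> h\<close>, so \<open>(-1)\<^bsup>m-1\<^esup> P\<close> is inverse to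
  \<open>\<phi>\<^sub>m\<close>.  Finally the differential of \<open>EK\<close> is \<open>P \<kappa> Kos h\<close>; since \<open>\<kappa> h \<kappa> = \<kappa>\<close> and \<open>\<kappa>\<close> anticommutes with
  \<open>Kos\<close>, this gives the compatibility with the differentials.
\<close>

interpretation free: module "smul :: 'r::comm_ring_1 \<Rightarrow> ('b \<Rightarrow>\<^sub>0 'r) \<Rightarrow> ('b \<Rightarrow>\<^sub>0 'r)"
  by (rule module_smul)

lemma module_times: "module ((*) :: 'r::comm_ring_1 \<Rightarrow> 'r \<Rightarrow> 'r)"
  by unfold_locales (simp_all add: algebra_simps)

lemma smul_single [simp]: "smul c (Poly_Mapping.single b r) = Poly_Mapping.single b (c * r)"
  by (auto intro!: poly_mapping_eqI simp: lookup_smul lookup_single when_def)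

lemma lin_ext_superset:
  assumes "finite S" "Poly_Mapping.keys v \<subseteq> S"
  shows "lin_ext f v = (\<Sum>b\<in>S. smul (Poly_Mapping.lookup v b) (f b))"
  unfolding lin_ext_def
  by (rule sum.mono_neutral_left) (use assms in \<open>auto simp: in_keys_iff\<close>)

lemma lin_form_superset:
  assumes "finite S" "Poly_Mapping.keys v \<subseteq> S"
  shows "lin_form f v = (\<Sum>b\<in>S. Poly_Mapping.lookup v b * f b)"
  unfolding lin_form_def
  by (rule sum.mono_neutral_left) (use assms in \<open>auto simp: in_keys_iff\<close>)

lemma keys_smul_subset: "Poly_Mapping.keys (smul c v) \<subseteq> Poly_Mapping.keys v"
  by (auto simp: in_keys_iff lookup_smul)

lemma module_hom_lin_ext:
  fixes f :: "'b \<Rightarrow> ('c \<Rightarrow>\<^sub>0 'r::comm_ring_1)"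
  shows "module_hom smul smul (lin_ext f)"
proof (intro module_hom.intro module_smul module_hom_axioms.intro)
  fix u v :: "'b \<Rightarrow>\<^sub>0 'r"
  let ?S = "Poly_Mapping.keys u \<union> Poly_Mapping.keys v"
  have "Poly_Mapping.keys (u + v) \<subseteq> ?S" by (rule Poly_Mapping.keys_add)
  then show "lin_ext f (u + v) = lin_ext f u + lin_ext f v"
    by (simp add: lin_ext_superset[of ?S] lookup_add free.scale_left_distrib sum.distrib)
next
  fix c :: 'r and v :: "'b \<Rightarrow>\<^sub>0 'r"
  show "lin_ext f (smul c v) = smul c (lin_ext f v)"
    by (simp add: lin_ext_superset[of "Poly_Mapping.keys v"] keys_smul_subset lookup_smul
        free.scale_sum_right)
qed

lemma module_hom_lin_form:
  fixes f :: "'b \<Rightarrow> 'r::comm_ring_1"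
  shows "module_hom smul (*) (lin_form f)"
proof (intro module_hom.intro module_smul module_times module_hom_axioms.intro)
  fix u v :: "'b \<Rightarrow>\<^sub>0 'r"
  let ?S = "Poly_Mapping.keys u \<union> Poly_Mapping.keys v"
  have "Poly_Mapping.keys (u + v) \<subseteq> ?S" by (rule Poly_Mapping.keys_add)
  then show "lin_form f (u + v) = lin_form f u + lin_form f v"
    by (simp add: lin_form_superset[of ?S] lookup_add distrib_right sum.distrib)
next
  fix c :: 'r and v :: "'b \<Rightarrow>\<^sub>0 'r"
  show "lin_form f (smul c v) = c * lin_form f v"
    by (simp add: lin_form_superset[of "Poly_Mapping.keys v"] keys_smul_subset lookup_smul
        sum_distrib_left mult.assoc)
qed

interpretation lin_ext: module_hom smul smul "lin_ext f" for f
  by (rule module_hom_lin_ext)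

text \<open>
  Interpreting the locale here would make \<open>a * (b * x) = (a * b) * x\<close> a simplification rule.
\<close>

lemmas lin_form_scale = module_hom.scale[OF module_hom_lin_form]
  and lin_form_sum = module_hom.sum[OF module_hom_lin_form]

lemma lin_ext_single [simp]: "lin_ext f (Poly_Mapping.single b c) = smul c (f b)"
  by (cases "c = 0") (simp_all add: lin_ext_def)

lemma lin_form_single [simp]: "lin_form f (Poly_Mapping.single b c) = c * f b"
  by (cases "c = 0") (simp_all add: lin_form_def)

lemma lin_ext_lin_ext: "lin_ext g (lin_ext f v) = lin_ext (\<lambda>b. lin_ext g (f b)) v"
  unfolding lin_ext_def[of f] lin_ext.sum lin_ext.scale by (simp add: lin_ext_def)

lemma lin_form_lin_ext: "lin_form g (lin_ext f v) = lin_form (\<lambda>b. lin_form g (f b)) v"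
  unfolding lin_ext_def[of f] lin_form_sum lin_form_scale by (simp add: lin_form_def)

lemma lin_ext_cong:
  "(\<And>b. b \<in> Poly_Mapping.keys v \<Longrightarrow> f b = g b) \<Longrightarrow> lin_ext f v = lin_ext g v"
  unfolding lin_ext_def by (auto intro!: sum.cong)

lemma lin_form_cong:
  "(\<And>b. b \<in> Poly_Mapping.keys v \<Longrightarrow> f b = g b) \<Longrightarrow> lin_form f v = lin_form g v"
  unfolding lin_form_def by (auto intro!: sum.cong)

lemma lin_ext_add_fun: "lin_ext (\<lambda>b. f b + g b) v = lin_ext f v + lin_ext g v"
  by (simp add: lin_ext_def free.scale_right_distrib sum.distrib)

lemma lin_ext_smul_fun: "lin_ext (\<lambda>b. smul c (f b)) v = smul c (lin_ext f v)"
  by (simp add: lin_ext_def free.scale_sum_right mult.commute)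

lemma lookup_lin_ext:
  "Poly_Mapping.lookup (lin_ext f v) c =
     (\<Sum>b\<in>Poly_Mapping.keys v. Poly_Mapping.lookup v b * Poly_Mapping.lookup (f b) c)"
  by (simp add: lin_ext_def lookup_sum lookup_smul)

lemma lin_ext_eq_self:
  assumes "\<And>b. b \<in> Poly_Mapping.keys v \<Longrightarrow> f b = Poly_Mapping.single b 1"
  shows "lin_ext f v = v"
proof -
  have "lin_ext f v = lin_ext (\<lambda>b. Poly_Mapping.single b 1) v"
    by (rule lin_ext_cong) (rule assms)
  also have "\<dots> = v"
    by (rule poly_mapping_eqI)
      (simp add: lookup_lin_ext lookup_single when_def in_keys_iff if_distrib[of "(*) _"]
        cong: if_cong)
  finally show ?thesis .
qed

lemma subspace_free_on: "free.subspace (free_on B)"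
proof (rule free.subspaceI)
  show "u + v \<in> free_on B" if "u \<in> free_on B" "v \<in> free_on B" for u v
    using that Poly_Mapping.keys_add[of u v] by (auto simp: free_on_def)
  show "smul c v \<in> free_on B" if "v \<in> free_on B" for c v
    using that keys_smul_subset[of c v] by (auto simp: free_on_def)
qed (simp add: free_on_def)

lemma single_in_free_on: "b \<in> B \<Longrightarrow> Poly_Mapping.single b c \<in> free_on B"
  by (simp add: free_on_def)

lemma lin_ext_in_free_on:
  assumes "v \<in> free_on B" "\<And>b. b \<in> B \<Longrightarrow> f b \<in> free_on C"
  shows "lin_ext f v \<in> free_on C"
  unfolding lin_ext_def
  by (intro free.subspace_sum free.subspace_scale subspace_free_on)
    (use assms in \<open>auto simp: free_on_def\<close>)

lemma free_onD: "v \<in> free_on B \<Longrightarrow> b \<in> Poly_Mapping.keys v \<Longrightarrow> b \<in> B"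
  by (auto simp: free_on_def)

definition restrict :: "'b set \<Rightarrow> ('b \<Rightarrow>\<^sub>0 'r::comm_ring_1) \<Rightarrow> ('b \<Rightarrow>\<^sub>0 'r)" where
  "restrict B = lin_ext (\<lambda>b. if b \<in> B then Poly_Mapping.single b 1 else 0)"

lemma restrict_single:
  "restrict B (Poly_Mapping.single b c) = (if b \<in> B then Poly_Mapping.single b c else 0)"
  by (simp add: restrict_def)

lemma restrict_add: "restrict B (u + v) = restrict B u + restrict B v"
  by (simp add: restrict_def lin_ext.add)

lemma restrict_smul: "restrict B (smul c v) = smul c (restrict B v)"
  by (simp add: restrict_def lin_ext.scale)

lemma restrict_sum: "restrict B (sum f S) = (\<Sum>x\<in>S. restrict B (f x))"
  by (simp add: restrict_def lin_ext.sum)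

lemma restrict_in_free_on:
  assumes "v \<in> free_on C"
  shows "restrict B v \<in> free_on (C \<inter> B)"
  unfolding restrict_def
  by (rule lin_ext_in_free_on[OF assms])
    (auto intro: single_in_free_on free.subspace_0[OF subspace_free_on])


section \<open>Koszul-type differentials\<close>

lemma sum_antisymmetric_eq_0:
  fixes f :: "'a \<Rightarrow> 'a \<Rightarrow> 'b::ab_group_add"
  assumes "finite A" "\<And>i j. i \<in> A \<Longrightarrow> j \<in> A \<Longrightarrow> i \<noteq> j \<Longrightarrow> f i j = - f j i"
  shows "(\<Sum>i\<in>A. \<Sum>j\<in>A - {i}. f i j) = 0"
  using assms
proof (induction A rule: finite_induct)
  case (insert a A)
  have "(\<Sum>j\<in>insert a A - {i}. f i j) = f i a + (\<Sum>j\<in>A - {i}. f i j)" if "i \<in> A" for i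
  proof -
    have "insert a A - {i} = insert a (A - {i})" using that insert.hyps by auto
    then show ?thesis using insert.hyps by simp
  qed
  then have "(\<Sum>i\<in>A. \<Sum>j\<in>insert a A - {i}. f i j) = (\<Sum>i\<in>A. f i a) + (\<Sum>i\<in>A. \<Sum>j\<in>A - {i}. f i j)"
    by (simp add: sum.distrib)
  also have "(\<Sum>i\<in>A. \<Sum>j\<in>A - {i}. f i j) = 0"
    by (rule insert.IH) (use insert.prems in blast)
  finally have "(\<Sum>i\<in>insert a A. \<Sum>j\<in>insert a A - {i}. f i j)
      = (\<Sum>j\<in>A. f a j) + (\<Sum>i\<in>A. f i a)"
    using insert.hyps by (simp add: insert_Diff_if)
  also have "\<dots> = (\<Sum>j\<in>A. f a j + f j a)"
    by (simp add: sum.distrib)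
  also have "\<dots> = 0"
  proof (rule sum.neutral, rule ballI)
    fix j assume "j \<in> A"
    then have "f a j = - f j a" using insert.hyps by (intro insert.prems) auto
    then show "f a j + f j a = 0" by simp
  qed
  finally show ?case .
qed simp

lemma pos_remove:
  fixes A :: "'n::{finite,linorder} set"
  assumes "i \<in> A"
  shows "pos A j = pos (A - {i}) j + (if i < j then 1 else 0)"
proof -
  have "{k \<in> A. k < j} = {k \<in> A - {i}. k < j} \<union> (if i < j then {i} else {})"
    using assms by auto
  then show ?thesis
    unfolding pos_def by (simp only:) (subst card_Un_disjoint; simp)
qed

lemma sign_remove_swap:
  fixes A :: "'n::{finite,linorder} set"
  assumes "i \<in> A" "j \<in> A" "i \<noteq> j"
  shows "(-1) ^ pos A i * (-1) ^ pos (A - {i}) j =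
    - ((-1) ^ pos A j * (-1) ^ pos (A - {j}) i :: 'r::comm_ring_1)"
  unfolding pos_remove[OF assms(1), of j] pos_remove[OF assms(2), of i]
  using assms(3) by (cases i j rule: linorder_cases) (simp_all add: order_less_not_sym)

lemma pos_Max:
  fixes A :: "'n::{finite,linorder} set"
  assumes "A \<noteq> {}"
  shows "pos A (Max A) = card A - 1"
proof -
  have "j < Max A" if "j \<in> A" "j \<noteq> Max A" for j
    using that Max_ge[of A j] by (simp add: order_less_le)
  then have "{j \<in> A. j < Max A} = A - {Max A}" by blast
  then show ?thesis
    unfolding pos_def using assms by (simp only:) (simp add: card_Diff_singleton)
qed

text \<open>
  The common shape of \<open>\<kappa>\<close> and of \<open>Kos\<^sup>\<psi> \<otimes> 1\<close>: a factor \<open>e\<^sub>i\<close> leaves the exterior part, acts on the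
  symmetric part by \<open>g i\<close> and contributes the scalar \<open>c i\<close>.
\<close>

definition peel ::
  "('n::{finite,linorder} \<Rightarrow> 'm \<Rightarrow> 'm) \<Rightarrow> ('n \<Rightarrow> 'r::comm_ring_1) \<Rightarrow>
   ('n set \<times> 'm \<Rightarrow>\<^sub>0 'r) \<Rightarrow> ('n set \<times> 'm \<Rightarrow>\<^sub>0 'r)" where
  "peel g c = lin_ext (\<lambda>(A, M).
     \<Sum>i\<in>A. Poly_Mapping.single (A - {i}, g i M) ((-1) ^ pos A i * c i))"

lemma peel_single:
  "peel g c (Poly_Mapping.single (A, M) r) =
     (\<Sum>i\<in>A. Poly_Mapping.single (A - {i}, g i M) (r * (-1) ^ pos A i * c i))"
  by (simp add: peel_def free.scale_sum_right mult.assoc)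

interpretation peel: module_hom smul smul "peel g c" for g c
  unfolding peel_def by (rule module_hom_lin_ext)

lemma peel_peel_single:
  "peel g c (peel g' c' (Poly_Mapping.single (A, M) 1)) =
     (\<Sum>i\<in>A. \<Sum>j\<in>A - {i}. Poly_Mapping.single (A - {i, j}, g j (g' i M))
        ((-1) ^ pos A i * (-1) ^ pos (A - {i}) j * (c' i * c j)))"
proof -
  have "A - {i} - {j} = A - {i, j}" for i j by auto
  then show ?thesis
    by (simp add: peel_single peel.sum mult_ac)
qed

lemma peel_peel_eq_lin_ext:
  "peel g c (peel g' c' v) = lin_ext (\<lambda>b. peel g c (peel g' c' (Poly_Mapping.single b 1))) v"
  by (simp add: peel_def lin_ext_lin_ext)

lemma peel_peel_eq_0:
  assumes "\<And>i j M. g i (g j M) = g j (g i M)"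
  shows "peel g c (peel g c v) = 0"
proof -
  have "peel g c (peel g c (Poly_Mapping.single (A, M) 1)) = 0" for A M
    unfolding peel_peel_single
  proof (rule sum_antisymmetric_eq_0)
    fix i j assume "i \<in> A" "j \<in> A" "i \<noteq> j"
    have sign: "(-1) ^ pos A i * (-1) ^ pos (A - {i}) j * (c i * c j) =
        - ((-1) ^ pos A j * (-1) ^ pos (A - {j}) i * (c j * c i))"
      unfolding sign_remove_swap[OF \<open>i \<in> A\<close> \<open>j \<in> A\<close> \<open>i \<noteq> j\<close>] mult.commute[of "c j" "c i"]
      by (rule mult_minus_left)
    show "Poly_Mapping.single (A - {i, j}, g j (g i M))
        ((-1) ^ pos A i * (-1) ^ pos (A - {i}) j * (c i * c j)) =
      - Poly_Mapping.single (A - {j, i}, g i (g j M))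
        ((-1) ^ pos A j * (-1) ^ pos (A - {j}) i * (c j * c i))"
      unfolding sign single_uminus insert_commute[of j i "{}"] assms[of j i M] by (rule refl)
  qed simp
  then have "peel g c (peel g c (Poly_Mapping.single b 1)) = 0" for b
    by (cases b) simp
  then show ?thesis
    by (subst peel_peel_eq_lin_ext) (simp add: lin_ext_def)
qed

lemma peel_anticommute:
  fixes c c' :: "'n::{finite,linorder} \<Rightarrow> 'r::comm_ring_1"
  assumes "\<And>i j M. g i (g' j M) = g' j (g i M)"
  shows "peel g c (peel g' c' v) = - peel g' c' (peel g c v)"
proof -
  have "peel g c (peel g' c' (Poly_Mapping.single (A, M) 1)) +
      peel g' c' (peel g c (Poly_Mapping.single (A, M) 1)) = 0" for A M
    unfolding peel_peel_single sum.distrib[symmetric]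
  proof (rule sum_antisymmetric_eq_0)
    fix i j assume "i \<in> A" "j \<in> A" "i \<noteq> j"
    have sign: "(-1) ^ pos A i * (-1) ^ pos (A - {i}) j * (x * y) =
        - ((-1) ^ pos A j * (-1) ^ pos (A - {j}) i * (y * x))" for x y :: 'r
      unfolding sign_remove_swap[OF \<open>i \<in> A\<close> \<open>j \<in> A\<close> \<open>i \<noteq> j\<close>] mult.commute[of y x]
      by (rule mult_minus_left)
    show "Poly_Mapping.single (A - {i, j}, g j (g' i M))
        ((-1) ^ pos A i * (-1) ^ pos (A - {i}) j * (c' i * c j)) +
      Poly_Mapping.single (A - {i, j}, g' j (g i M))
        ((-1) ^ pos A i * (-1) ^ pos (A - {i}) j * (c i * c' j)) =
      - (Poly_Mapping.single (A - {j, i}, g i (g' j M))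
        ((-1) ^ pos A j * (-1) ^ pos (A - {j}) i * (c' j * c i)) +
      Poly_Mapping.single (A - {j, i}, g' i (g j M))
        ((-1) ^ pos A j * (-1) ^ pos (A - {j}) i * (c j * c' i)))"
      unfolding sign[of "c' i" "c j"] sign[of "c i" "c' j"] single_uminus insert_commute[of j i "{}"]
        assms[of i j M] assms[of j i M]
      by (simp only: minus_add_distrib add.commute)
  qed simp
  then have "peel g c (peel g' c' (Poly_Mapping.single b 1)) +
      peel g' c' (peel g c (Poly_Mapping.single b 1)) = 0" for b
    by (cases b) simp
  then have "lin_ext (\<lambda>b. peel g c (peel g' c' (Poly_Mapping.single b 1)) +
      peel g' c' (peel g c (Poly_Mapping.single b 1))) v = 0"
    by (simp add: lin_ext_def)
  then have "peel g c (peel g' c' v) + peel g' c' (peel g c v) = 0"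
    unfolding lin_ext_add_fun peel_peel_eq_lin_ext[symmetric] .
  then show ?thesis by (simp add: eq_neg_iff_add_eq_0)
qed

lemma kappa_eq_peel: "kappa = peel add_mset (\<lambda>_. 1)"
proof
  fix v show "kappa v = peel add_mset (\<lambda>_. 1) v"
    unfolding kappa_def sym_mult_def comult_def peel_def lin_ext_lin_ext
    by (rule lin_ext_cong) (simp add: split_beta lin_ext.sum)
qed

lemma koszul_eq_peel: "koszul \<psi> = peel (\<lambda>_ M. M) \<psi>"
  by (simp add: koszul_def peel_def)

interpretation kappa: module_hom smul smul kappa
  unfolding kappa_eq_peel by (rule peel.module_hom_axioms)

interpretation koszul: module_hom smul smul "koszul \<psi>" for \<psi>
  unfolding koszul_eq_peel by (rule peel.module_hom_axioms)

lemma kappa_kappa [simp]: "kappa (kappa v) = 0"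
  unfolding kappa_eq_peel by (rule peel_peel_eq_0) (rule add_mset_commute)

lemma koszul_koszul [simp]: "koszul \<psi> (koszul \<psi> v) = 0"
  unfolding koszul_eq_peel by (rule peel_peel_eq_0) simp

lemma koszul_kappa: "koszul \<psi> (kappa v) = - kappa (koszul \<psi> v)"
  unfolding koszul_eq_peel kappa_eq_peel by (rule peel_anticommute) simp

lemma kappa_single:
  "kappa (Poly_Mapping.single (A, M) r) =
     (\<Sum>i\<in>A. Poly_Mapping.single (A - {i}, add_mset i M) (r * (-1) ^ pos A i))"
  by (simp add: kappa_eq_peel peel_single)

lemma koszul_single:
  "koszul \<psi> (Poly_Mapping.single (A, M) r) =
     (\<Sum>i\<in>A. Poly_Mapping.single (A - {i}, M) (r * (-1) ^ pos A i * \<psi> i))"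
  by (simp add: koszul_eq_peel peel_single)

lemma kappa_in_ext_sym_part:
  assumes "v \<in> ext_sym_part a b"
  shows "kappa v \<in> ext_sym_part (a - 1) (Suc b)"
  unfolding kappa_eq_peel peel_def ext_sym_part_def
  by (rule lin_ext_in_free_on[OF assms[unfolded ext_sym_part_def]])
    (auto intro!: free.subspace_sum subspace_free_on single_in_free_on)

lemma koszul_in_ext_sym_part:
  assumes "v \<in> ext_sym_part a b"
  shows "koszul \<psi> v \<in> ext_sym_part (a - 1) b"
  unfolding koszul_def ext_sym_part_def
  by (rule lin_ext_in_free_on[OF assms[unfolded ext_sym_part_def]])
    (auto intro!: free.subspace_sum subspace_free_on single_in_free_on)


section \<open>A contracting homotopy\<close>

definition EK_pairs :: "('n::{finite,linorder} set \<times> 'n multiset) set" where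
  "EK_pairs = {(I, J). J \<noteq> {#} \<and> (\<forall>i\<in>I. i < Max_mset J)}"

text \<open>
  Off \<open>EK_pairs\<close> every basis element other than \<open>({}, {#})\<close> has its maximal index in the exterior
  part.
\<close>

definition homotopy ::
  "('n::{finite,linorder} set \<times> 'n multiset \<Rightarrow>\<^sub>0 'r::comm_ring_1) \<Rightarrow> ('n set \<times> 'n multiset \<Rightarrow>\<^sub>0 'r)" where
  "homotopy = lin_ext (\<lambda>(I, J). if (I, J) \<in> EK_pairs
     then Poly_Mapping.single (insert (Max_mset J) I, J - {#Max_mset J#}) ((-1) ^ card I) else 0)"

interpretation homotopy: module_hom smul smul homotopy
  unfolding homotopy_def by (rule module_hom_lin_ext)

lemma homotopy_single:
  "(I, J) \<in> EK_pairs \<Longrightarrow> homotopy (Poly_Mapping.single (I, J) r) =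
     Poly_Mapping.single (insert (Max_mset J) I, J - {#Max_mset J#}) (r * (-1) ^ card I)"
  by (simp add: homotopy_def)

lemma homotopy_single_eq_0: "b \<notin> EK_pairs \<Longrightarrow> homotopy (Poly_Mapping.single b r) = 0"
  by (auto simp: homotopy_def split_beta)

lemma Max_insert_mset_eq: "\<forall>x\<in>#M. x \<le> t \<Longrightarrow> Max (insert t (set_mset M)) = (t::'n::linorder)"
  by (rule Max_eqI) auto

lemma add_mset_Max_in_EK_pairs:
  fixes A :: "'n::{finite,linorder} set"
  assumes "\<forall>x\<in>#M. x \<le> Max A"
  shows "(A - {Max A}, add_mset (Max A) M) \<in> EK_pairs"
proof -
  have "j < Max A" if "j \<in> A" "j \<noteq> Max A" for j
    using that Max_ge[of A j] by (simp add: order_less_le)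
  then show ?thesis
    unfolding EK_pairs_def using Max_insert_mset_eq[OF assms] by simp
qed

lemma add_mset_notin_EK_pairs:
  fixes A :: "'n::{finite,linorder} set"
  assumes "A \<noteq> {}" "\<forall>x\<in>#M. x \<le> Max A" "i \<in> A" "i \<noteq> Max A"
  shows "(A - {i}, add_mset i M) \<notin> EK_pairs"
proof -
  have "Max_mset (add_mset i M) \<le> Max A"
    using assms by (intro Max.boundedI) auto
  moreover have "Max A \<in> A - {i}" using assms Max_in[of A] by auto
  moreover have "Max A < Max_mset (add_mset i M)"
    if "(A - {i}, add_mset i M) \<in> EK_pairs" "Max A \<in> A - {i}"
    using that unfolding EK_pairs_def by blast
  ultimately show ?thesis by (blast dest: leD)
qed

lemma EK_pairs_cases:
  fixes A :: "'n::{finite,linorder} set"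
  assumes "M \<noteq> {#}"
  obtains "(A, M) \<in> EK_pairs" | "(A, M) \<notin> EK_pairs" "A \<noteq> {}" "\<forall>x\<in>#M. x \<le> Max A"
proof (cases "(A, M) \<in> EK_pairs")
  case False
  then obtain i where i: "i \<in> A" "\<not> i < Max_mset M"
    using assms by (auto simp: EK_pairs_def)
  have "x \<le> Max A" if "x \<in># M" for x
  proof -
    have "x \<le> Max_mset M" using that by simp
    also have "\<dots> \<le> i" using i by simp
    also have "i \<le> Max A" using i by simp
    finally show ?thesis .
  qed
  then show ?thesis using that False i by blast
qed

lemma EK_pairs_Max:
  assumes "(I, J) \<in> EK_pairs"
  defines "s \<equiv> Max_mset J"
  shows "s \<in># J" "s \<notin> I" "Max (insert s I) = s" "\<forall>x\<in>#J - {#s#}. x \<le> Max (insert s I)"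
proof -
  show "s \<in># J" "s \<notin> I" using assms by (auto simp: EK_pairs_def)
  show eq: "Max (insert s I) = s"
    by (rule Max_eqI) (use assms in \<open>auto simp: EK_pairs_def intro: less_imp_le\<close>)
  show "\<forall>x\<in>#J - {#s#}. x \<le> Max (insert s I)"
  proof
    fix x assume "x \<in># J - {#s#}"
    then have "x \<in># J" by (rule in_diffD)
    then show "x \<le> Max (insert s I)" unfolding eq by (simp add: s_def)
  qed
qed

lemma EK_pairs_pos:
  assumes "(I, J) \<in> EK_pairs" "i \<in> I"
  shows "pos (insert (Max_mset J) I) i = pos I i"
proof -
  have "i < Max_mset J" using assms unfolding EK_pairs_def by blast
  then have "\<not> Max_mset J < i" by (rule order_less_not_sym)
  then show ?thesis
    using pos_remove[of "Max_mset J" "insert (Max_mset J) I" i] EK_pairs_Max(2)[OF assms(1)]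
    by simp
qed

lemma kappa_single_split:
  fixes A :: "'n::{finite,linorder} set"
  assumes "A \<noteq> {}"
  shows "kappa (Poly_Mapping.single (A, M) r) =
    Poly_Mapping.single (A - {Max A}, add_mset (Max A) M) (r * (-1) ^ (card A - 1)) +
    (\<Sum>i\<in>A - {Max A}. Poly_Mapping.single (A - {i}, add_mset i M) (r * (-1) ^ pos A i))"
  unfolding kappa_single using assms
  by (subst sum.remove[of A "Max A"]) (simp_all add: pos_Max)

lemma homotopy_restrict: "homotopy (restrict EK_pairs v) = homotopy v"
  unfolding homotopy_def restrict_def lin_ext_lin_ext by (rule lin_ext_cong) auto

lemma homotopy_kappa_single:
  fixes A :: "'n::{finite,linorder} set" and r :: "('n, 'k::comm_ring_1) polyring"
  assumes "A \<noteq> {}" "\<forall>x\<in>#M. x \<le> Max A"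
  shows "homotopy (kappa (Poly_Mapping.single (A, M) r)) = Poly_Mapping.single (A, M) r"
proof -
  have "homotopy (Poly_Mapping.single (A - {i}, add_mset i M) c) = 0" if "i \<in> A - {Max A}" for i and c :: "('n, 'k) polyring"
    using that add_mset_notin_EK_pairs[OF assms] by (intro homotopy_single_eq_0) auto
  moreover have "insert (Max A) A = A" using assms by (intro insert_absorb Max_in) auto
  ultimately show ?thesis
    unfolding kappa_single_split[OF assms(1)] homotopy.add homotopy.sum
    using assms
    by (simp add: homotopy_single[OF add_mset_Max_in_EK_pairs] Max_insert_mset_eq
        mult.assoc flip: power_add)
qed

lemma restrict_kappa_single:
  fixes A :: "'n::{finite,linorder} set" and r :: "('n, 'k::comm_ring_1) polyring"
  assumes "A \<noteq> {}" "\<forall>x\<in>#M. x \<le> Max A"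
  shows "restrict EK_pairs (kappa (Poly_Mapping.single (A, M) r)) =
    Poly_Mapping.single (A - {Max A}, add_mset (Max A) M) (r * (-1) ^ (card A - 1))"
proof -
  have "restrict EK_pairs (Poly_Mapping.single (A - {i}, add_mset i M) c) = 0"
    if "i \<in> A - {Max A}" for i and c :: "('n, 'k) polyring"
    using that add_mset_notin_EK_pairs[OF assms] by (simp add: restrict_single)
  then show ?thesis
    unfolding kappa_single_split[OF assms(1)] restrict_add restrict_sum
    using assms by (simp add: restrict_single add_mset_Max_in_EK_pairs)
qed

lemma restrict_kappa_homotopy:
  fixes w :: "('n::{finite,linorder}, 'k::comm_ring_1) ek"
  assumes "w \<in> free_on EK_pairs"
  shows "restrict EK_pairs (kappa (homotopy w)) = w"
proof -
  have "restrict EK_pairs (kappa (homotopy (Poly_Mapping.single b 1))) =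
      (Poly_Mapping.single b 1 :: ('n, 'k) ek)"
    if "b \<in> EK_pairs" for b :: "'n set \<times> 'n multiset"
  proof (cases b)
    case (Pair I J)
    note IJ = that[unfolded Pair]
    note m = EK_pairs_Max[OF IJ]
    show ?thesis
      unfolding Pair homotopy_single[OF IJ]
      by (subst restrict_kappa_single[OF insert_not_empty m(4)])
        (use m(1-3) in \<open>simp add: mult.assoc flip: power_add\<close>)
  qed
  then have "lin_ext (\<lambda>b. restrict EK_pairs (kappa (homotopy (Poly_Mapping.single b 1)))) w = w"
    by (intro lin_ext_eq_self) (use assms in \<open>auto dest: free_onD\<close>)
  then show ?thesis
    by (simp add: restrict_def kappa_eq_peel peel_def homotopy_def lin_ext_lin_ext)
qed

lemma homotopy_identity:
  fixes v :: "('n::{finite,linorder}, 'k::comm_ring_1) ext_sym"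
  assumes "v \<in> free_on {(A, M). M \<noteq> {#}}"
  shows "kappa (homotopy v) + homotopy (kappa v) = v"
proof -
  have "kappa (homotopy (Poly_Mapping.single b 1)) + homotopy (kappa (Poly_Mapping.single b 1)) =
      (Poly_Mapping.single b 1 :: ('n, 'k) ext_sym)"
    if "b \<in> {(A, M). M \<noteq> {#}}" for b :: "'n set \<times> 'n multiset"
  proof (cases b)
    case (Pair I J)
    have "J \<noteq> {#}" using that Pair by simp
    then show ?thesis
    proof (cases rule: EK_pairs_cases[where A = I])
      case 2
      then show ?thesis
        unfolding Pair by (simp add: homotopy_single_eq_0 homotopy_kappa_single)
    next
      case 1
      define s where "s = Max_mset J"
      note m = EK_pairs_Max[OF 1, folded s_def]
      have s_notin: "s \<noteq> i" if "i \<in> I" for i using m(2) that by auto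
      have card: "Suc (card (I - {i})) = card I" if "i \<in> I" for i
        using that by (intro card_Suc_Diff1) simp_all
      have le: "\<forall>x\<in>#J. x \<le> s" by (simp add: s_def)
      have "i \<le> s" if "i \<in> I" for i using 1 that by (auto simp: EK_pairs_def s_def)
      then have Max_add: "Max_mset (add_mset i J) = s" if "i \<in> I" for i
        by (intro Max_eqI) (use le m(1) that in auto)
      have mem: "(I - {i}, add_mset i J) \<in> EK_pairs" if "i \<in> I" for i
        unfolding EK_pairs_def using 1 Max_add[OF that] by (auto simp: EK_pairs_def s_def)
      note pos_eq = EK_pairs_pos[OF 1, folded s_def]
      have "homotopy (kappa (Poly_Mapping.single (I, J) 1) :: ('n, 'k) ext_sym) =
        (\<Sum>i\<in>I. Poly_Mapping.single (insert s (I - {i}), add_mset i J - {#s#})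
           ((-1) ^ pos I i * (-1) ^ card (I - {i})))"
        unfolding kappa_single homotopy.sum
        by (intro sum.cong) (simp_all add: homotopy_single[OF mem] Max_add[simplified])
      also have "\<dots> = - (\<Sum>i\<in>I. Poly_Mapping.single (insert s I - {i}, add_mset i (J - {#s#}))
           ((-1) ^ card I * (-1) ^ pos (insert s I) i))"
        unfolding sum_negf[symmetric]
      proof (intro sum.cong)
        fix i assume i: "i \<in> I"
        then have "insert s I - {i} = insert s (I - {i})" using s_notin by auto
        moreover have "add_mset i J - {#s#} = add_mset i (J - {#s#})" using m(1) by simp
        moreover have "(-1) ^ pos I i * (-1) ^ card (I - {i}) =
            (- ((-1) ^ card I * (-1) ^ pos (insert s I) i) :: ('n, 'k) polyring)"
          unfolding card[OF i, symmetric] pos_eq[OF i] by (simp only: power_Suc) (simp add: mult.commute)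
        ultimately show "(Poly_Mapping.single (insert s (I - {i}), add_mset i J - {#s#})
            ((-1) ^ pos I i * (-1) ^ card (I - {i})) :: ('n, 'k) ext_sym) =
          - Poly_Mapping.single (insert s I - {i}, add_mset i (J - {#s#}))
           ((-1) ^ card I * (-1) ^ pos (insert s I) i)"
          by (simp only: single_uminus)
      qed simp
      finally have hk: "homotopy (kappa (Poly_Mapping.single (I, J) 1)) = \<dots>" .
      have "kappa (homotopy (Poly_Mapping.single (I, J) 1) :: ('n, 'k) ext_sym) =
        Poly_Mapping.single (I, J) 1 +
        (\<Sum>i\<in>I. Poly_Mapping.single (insert s I - {i}, add_mset i (J - {#s#}))
           ((-1) ^ card I * (-1) ^ pos (insert s I) i))"
        unfolding homotopy_single[OF 1, folded s_def]
        by (subst kappa_single_split)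
          (use m(1-3) in \<open>simp_all add: mult.assoc flip: power_add\<close>)
      then show ?thesis unfolding Pair hk by simp
    qed
  qed
  then have "lin_ext (\<lambda>b. kappa (homotopy (Poly_Mapping.single b 1)) +
      homotopy (kappa (Poly_Mapping.single b 1))) v = v"
    by (intro lin_ext_eq_self) (use assms in \<open>auto dest!: free_onD\<close>)
  then show ?thesis
    unfolding lin_ext_add_fun
    by (simp add: kappa_eq_peel peel_def homotopy_def lin_ext_lin_ext)
qed

lemma kappa_homotopy_kappa: "kappa (homotopy (kappa v)) = kappa v"
proof -
  have "kappa v \<in> free_on {(A, M). M \<noteq> {#}}"
    unfolding kappa_eq_peel peel_def
    by (rule lin_ext_in_free_on[of _ UNIV])
      (auto simp: free_on_def[of UNIV] intro!: free.subspace_sum subspace_free_on single_in_free_on)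
  from homotopy_identity[OF this] show ?thesis by simp
qed


section \<open>The Eliahou--Kervaire complex\<close>

lemma EK_complex_subset: "d \<ge> 1 \<Longrightarrow> EK_complex d m \<subseteq> free_on EK_pairs"
  by (fastforce simp: EK_complex_def free_on_def EK_pairs_def)

lemma restrict_in_EK_complex:
  assumes "v \<in> ext_sym_part (m - 1) d"
  shows "restrict EK_pairs v \<in> EK_complex d m"
  using restrict_in_free_on[OF assms[unfolded ext_sym_part_def], of EK_pairs]
  by (auto simp: EK_complex_def free_on_def EK_pairs_def)

lemma homotopy_in_ext_sym_part:
  fixes w :: "('n::{finite,linorder}, 'k::comm_ring_1) ek"
  assumes "w \<in> EK_complex d m" "d \<ge> 1" "m \<ge> 1"
  shows "homotopy w \<in> ext_sym_part m (d - 1)"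
  unfolding homotopy_def ext_sym_part_def
proof (rule lin_ext_in_free_on[OF assms(1)[unfolded EK_complex_def]])
  fix b :: "'n set \<times> 'n multiset"
  assume b: "b \<in> {(I, J). card I = m - 1 \<and> size J = d \<and> (\<forall>i\<in>I. i < Max_mset J)}"
  obtain I J where [simp]: "b = (I, J)" by (cases b)
  have E: "(I, J) \<in> EK_pairs" using b assms(2) by (auto simp: EK_pairs_def)
  then have "card (insert (Max_mset J) I) = m" "size (J - {#Max_mset J#}) = d - 1"
    using b assms(3) EK_pairs_Max(1,2)[OF E] by (simp_all add: size_Diff_singleton)
  then show "(case b of (I, J) \<Rightarrow> if (I, J) \<in> EK_pairs
      then Poly_Mapping.single (insert (Max_mset J) I, J - {#Max_mset J#}) ((-1) ^ card I) else 0)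
      \<in> free_on {(A, M). card A = m \<and> size M = d - 1}"
    using E by (simp add: single_in_free_on)
qed

lemma inversions_sorted: "sorted xs \<Longrightarrow> inversions xs = 0"
proof -
  assume "sorted xs"
  then have "{(p, q). p < q \<and> q < length xs \<and> xs ! q < xs ! p} = {}"
    by (auto simp: sorted_iff_nth_mono_less leD)
  then show ?thesis unfolding inversions_def by (simp only: card.empty)
qed

lemma inversions_Cons:
  assumes "sorted xs" "\<forall>x\<in>set xs. x < y"
  shows "inversions (y # xs) = length xs"
proof -
  have "{(p, q). p < q \<and> q < length (y # xs) \<and> (y # xs) ! q < (y # xs) ! p} =
      (\<lambda>q. (0, Suc q)) ` {..<length xs}" (is "?L = ?R")
  proof
    show "?L \<subseteq> ?R"
    proof clarify
      fix p q assume pq: "p < q" "q < length (y # xs)" "(y # xs) ! q < (y # xs) ! p"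
      then obtain q' where q: "q = Suc q'" by (cases q) auto
      have "p = 0"
      proof (rule ccontr)
        assume "p \<noteq> 0"
        then obtain p' where "p = Suc p'" by (cases p) auto
        then show False using pq q sorted_nth_mono[OF assms(1), of p' q'] by auto
      qed
      then show "(p, q) \<in> ?R" using pq q by auto
    qed
    show "?R \<subseteq> ?L" using assms(2) by auto
  qed
  then show ?thesis unfolding inversions_def by (simp add: card_image inj_on_def)
qed

lemma phi_eq:
  fixes w :: "('n::{finite,linorder}, 'k::comm_ring_1) ek"
  assumes "d \<ge> 1" "w \<in> EK_complex d m"
  shows "phi m w = smul ((-1) ^ (m - 1)) (kappa (homotopy w))"
proof -
  have "phi m w = lin_ext (\<lambda>b. smul ((-1) ^ (m - 1))
      (kappa (homotopy (Poly_Mapping.single b 1)))) w"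
    unfolding phi_def
  proof (rule lin_ext_cong)
    fix b assume b: "b \<in> Poly_Mapping.keys w"
    obtain I J where [simp]: "b = (I, J)" by (cases b)
    have E: "(I, J) \<in> EK_pairs"
      using EK_complex_subset[OF assms(1)] assms(2) b by (auto dest: free_onD)
    then have "\<forall>i\<in>I. i < Max_mset J" by (simp add: EK_pairs_def)
    then have "L_tableau (Max_mset J # sorted_list_of_set I) (J - {#Max_mset J#}) =
        (kappa (homotopy (Poly_Mapping.single (I, J) 1)) :: ('n, 'k) ext_sym)"
      by (auto simp: L_tableau_def wedge_tensor_def homotopy_single[OF E] inversions_Cons)
    then show "(case b of (I, J) \<Rightarrow> let jd = Max_mset J in smul ((-1) ^ (m - 1))
        (L_tableau (jd # sorted_list_of_set I) (J - {#jd#}))) =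
      (smul ((-1) ^ (m - 1)) (kappa (homotopy (Poly_Mapping.single b 1))) :: ('n, 'k) ext_sym)"
      by (simp add: Let_def)
  qed
  then show ?thesis
    unfolding lin_ext_smul_fun by (simp add: kappa_eq_peel peel_def homotopy_def lin_ext_lin_ext)
qed

lemma sum_sorted_list_of_set:
  fixes I :: "'n::{finite,linorder} set"
  shows "(\<Sum>l<length (sorted_list_of_set I). f l (sorted_list_of_set I ! l)) =
    (\<Sum>i\<in>I. f (pos I i) i)"
proof -
  let ?is = "sorted_list_of_set I"
  have pos: "pos I (?is ! l) = l" if "l < length ?is" for l
  proof -
    have "{j \<in> I. j < ?is ! l} = (!) ?is ` {..<l}"
    proof (intro equalityI subsetI)
      fix j assume "j \<in> {j \<in> I. j < ?is ! l}"
      then have "j \<in> set ?is" "j < ?is ! l" by auto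
      then obtain k where k: "k < length ?is" "j = ?is ! k" unfolding in_set_conv_nth by blast
      then have "k < l"
        using \<open>j < ?is ! l\<close> sorted_nth_mono[of ?is l k] by (cases "k < l") auto
      then show "j \<in> (!) ?is ` {..<l}" using k by blast
    next
      fix j assume "j \<in> (!) ?is ` {..<l}"
      then obtain k where k: "k < l" "j = ?is ! k" by auto
      then have "j < ?is ! l"
        using that sorted_wrt_nth_less[OF strict_sorted_list_of_set, of k l I] by auto
      moreover have "j \<in> I"
        using k that nth_mem[of k ?is] by simp
      ultimately show "j \<in> {j \<in> I. j < ?is ! l}" by simp
    qed
    moreover have "inj_on ((!) ?is) {..<l}"
      using that by (intro inj_on_nth) auto
    ultimately show ?thesis by (simp add: pos_def card_image)
  qed
  have "bij_betw ((!) ?is) {..<length ?is} I"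
    by (intro bij_betw_nth) auto
  then have "(\<Sum>i\<in>I. f (pos I i) i) = (\<Sum>l<length ?is. f (pos I (?is ! l)) (?is ! l))"
    by (rule sum.reindex_bij_betw[symmetric])
  also have "\<dots> = (\<Sum>l<length ?is. f l (?is ! l))"
    by (rule sum.cong) (simp_all only: pos lessThan_iff)
  finally show ?thesis by (rule sym)
qed

lemma EK_symbol_delete_nth:
  fixes I :: "'n::{finite,linorder} set"
  assumes "J \<noteq> {#}" "l < length (sorted_list_of_set I)"
  shows "EK_symbol (delete_nth l (sorted_list_of_set I)) J =
    restrict EK_pairs (Poly_Mapping.single (I - {sorted_list_of_set I ! l}, J) 1)"
proof -
  let ?is = "sorted_list_of_set I"
  define ys where "ys = delete_nth l ?is"
  have split: "?is = take l ?is @ ?is ! l # drop (Suc l) ?is"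
    by (rule id_take_nth_drop[OF assms(2)])
  have "sorted (take l ?is @ ?is ! l # drop (Suc l) ?is)"
    "distinct (take l ?is @ ?is ! l # drop (Suc l) ?is)"
    "set (take l ?is @ ?is ! l # drop (Suc l) ?is) = I"
    unfolding split[symmetric] by simp_all
  then have "sorted ys" "distinct ys" "set ys = I - {?is ! l}"
    unfolding ys_def delete_nth_def by (auto simp: sorted_append)
  then show ?thesis
    unfolding ys_def[symmetric]
    using assms(1) by (auto simp: EK_symbol_def restrict_single EK_pairs_def inversions_sorted)
qed

lemma EK_diff_eq:
  fixes w :: "('n::{finite,linorder}, 'k::comm_ring_1) ek"
  assumes "w \<in> free_on EK_pairs"
  shows "EK_diff w = restrict EK_pairs (kappa (koszul polyvar (homotopy w)))"
proof -
  have "EK_diff w = lin_ext (\<lambda>b. restrict EK_pairs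
      (kappa (koszul polyvar (homotopy (Poly_Mapping.single b 1))))) w"
    unfolding EK_diff_def
  proof (rule lin_ext_cong)
    fix b assume "b \<in> Poly_Mapping.keys w"
    then have "b \<in> EK_pairs" by (rule free_onD[OF assms])
    moreover obtain I J where [simp]: "b = (I, J)" by (cases b)
    ultimately have E: "(I, J) \<in> EK_pairs" by simp
    define s where "s = Max_mset J"
    define N where "N = J - {#s#}"
    let ?is = "sorted_list_of_set I"
    note m = EK_pairs_Max[OF E, folded s_def]
    have J: "add_mset s N = J" "J \<noteq> {#}" using m(1) by (auto simp: N_def)
    have "(\<Sum>l<length ?is. smul ((-1) ^ Suc l * polyvar (?is ! l)) (EK_symbol (delete_nth l ?is) J))
      = (\<Sum>l<length ?is. smul ((-1) ^ Suc l * polyvar (?is ! l))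
          (restrict EK_pairs (Poly_Mapping.single (I - {?is ! l}, J) 1)) :: ('n, 'k) ek)"
      by (intro sum.cong) (simp_all only: EK_symbol_delete_nth J lessThan_iff not_False_eq_True)
    also have "\<dots> = (\<Sum>i\<in>I. smul ((-1) ^ Suc (pos I i) * polyvar i)
          (restrict EK_pairs (Poly_Mapping.single (I - {i}, J) 1)))"
      by (rule sum_sorted_list_of_set)
    finally have 1: "(\<Sum>l<length ?is. smul ((-1) ^ Suc l * polyvar (?is ! l))
        (EK_symbol (delete_nth l ?is) J) :: ('n, 'k) ek) = \<dots>" .
    have "(\<Sum>l<length ?is. smul ((-1) ^ Suc l * polyvar s)
        (EK_symbol (delete_nth l ?is) (add_mset (?is ! l) N)))
      = (\<Sum>l<length ?is. smul ((-1) ^ Suc l * polyvar s)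
          (restrict EK_pairs (Poly_Mapping.single (I - {?is ! l}, add_mset (?is ! l) N) 1)) :: ('n, 'k) ek)"
      by (intro sum.cong)
        (simp_all only: EK_symbol_delete_nth add_mset_not_empty lessThan_iff not_False_eq_True)
    also have "\<dots> = (\<Sum>i\<in>I. smul ((-1) ^ Suc (pos I i) * polyvar s)
          (restrict EK_pairs (Poly_Mapping.single (I - {i}, add_mset i N) 1)))"
      by (rule sum_sorted_list_of_set)
    finally have 2: "(\<Sum>l<length ?is. smul ((-1) ^ Suc l * polyvar s)
        (EK_symbol (delete_nth l ?is) (add_mset (?is ! l) N)) :: ('n, 'k) ek) = \<dots>" .
    have pos_s: "pos (insert s I) s = card I"
      using pos_Max[of "insert s I"] m(2,3) by simp
    have "koszul polyvar (homotopy (Poly_Mapping.single (I, J) 1)) =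
      (Poly_Mapping.single (I, N) (polyvar s) +
      (\<Sum>i\<in>I. Poly_Mapping.single (insert s I - {i}, N)
         ((-1) ^ card I * (-1) ^ pos I i * polyvar i)) :: ('n, 'k) ek)"
    proof -
      have "insert s I - {s} = I" using m(2) by simp
      then show ?thesis
        unfolding homotopy_single[OF E, folded s_def, folded N_def] koszul_single
          sum.insert[OF finite m(2)] pos_s
        by (auto simp: EK_pairs_pos[OF E, folded s_def] simp flip: power_add intro!: sum.cong)
    qed
    then have "restrict EK_pairs (kappa (koszul polyvar (homotopy (Poly_Mapping.single (I, J) 1)))) =
      (restrict EK_pairs (kappa (Poly_Mapping.single (I, N) (polyvar s))) +
      (\<Sum>i\<in>I. restrict EK_pairs (kappa (Poly_Mapping.single (insert s I - {i}, N)
         ((-1) ^ card I * (-1) ^ pos I i * polyvar i)))) :: ('n, 'k) ek)"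
      by (simp only: kappa.add kappa.sum restrict_add restrict_sum)
    also have "restrict EK_pairs (kappa (Poly_Mapping.single (I, N) (polyvar s))) =
      - (\<Sum>i\<in>I. smul ((-1) ^ Suc (pos I i) * polyvar s)
        (restrict EK_pairs (Poly_Mapping.single (I - {i}, add_mset i N) 1)) :: ('n, 'k) ek)"
      unfolding kappa_single restrict_sum sum_negf[symmetric]
      by (intro sum.cong) (auto simp: restrict_single mult.commute single_uminus)
    also have "(\<Sum>i\<in>I. restrict EK_pairs (kappa (Poly_Mapping.single (insert s I - {i}, N)
         ((-1) ^ card I * (-1) ^ pos I i * polyvar i)))) =
      (\<Sum>i\<in>I. smul ((-1) ^ Suc (pos I i) * polyvar i)
          (restrict EK_pairs (Poly_Mapping.single (I - {i}, J) 1)) :: ('n, 'k) ek)"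
    proof (intro sum.cong)
      fix i assume i: "i \<in> I"
      have Ei: "(I - {i}, J) \<in> EK_pairs" using E by (auto simp: EK_pairs_def)
      note mi = EK_pairs_Max[OF Ei, folded s_def, folded N_def]
      have A: "insert s I - {i} = insert s (I - {i})" using i m(2) by auto
      have card: "card I = Suc (card (I - {i}))"
        using i by (intro card_Suc_Diff1[symmetric]) simp_all
      have "restrict EK_pairs (kappa (Poly_Mapping.single (insert s I - {i}, N)
          ((-1) ^ card I * (-1) ^ pos I i * polyvar i))) =
        (Poly_Mapping.single (I - {i}, J)
          ((-1) ^ card I * (-1) ^ pos I i * polyvar i * (-1) ^ card (I - {i})) :: ('n, 'k) ek)"
        unfolding A using mi(2)
        by (subst restrict_kappa_single[OF insert_not_empty mi(4)]) (simp add: mi(3) J)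
      also have "((-1) ^ card I * (-1) ^ pos I i * polyvar i * (-1) ^ card (I - {i}))
        = ((-1) ^ (card I + card (I - {i}))) * ((-1) ^ pos I i * polyvar i :: ('n, 'k) polyring)"
        by (simp only: power_add mult_ac)
      also have "\<dots> = (-1) ^ Suc (pos I i) * polyvar i"
        unfolding card by simp
      finally show "restrict EK_pairs (kappa (Poly_Mapping.single (insert s I - {i}, N)
          ((-1) ^ card I * (-1) ^ pos I i * polyvar i))) =
        (smul ((-1) ^ Suc (pos I i) * polyvar i)
          (restrict EK_pairs (Poly_Mapping.single (I - {i}, J) 1)) :: ('n, 'k) ek)"
        using Ei by (simp add: restrict_single)
    qed simp
    finally show "(case b of (I, J) \<Rightarrow> let is = sorted_list_of_set I; jd = Max_mset J in
        (\<Sum>l<length is. smul ((-1) ^ Suc l * polyvar (is ! l)) (EK_symbol (delete_nth l is) J)) -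
        (\<Sum>l<length is. smul ((-1) ^ Suc l * polyvar jd)
          (EK_symbol (delete_nth l is) (add_mset (is ! l) (J - {#jd#}))))) =
      (restrict EK_pairs (kappa (koszul polyvar (homotopy (Poly_Mapping.single b 1)))) :: ('n, 'k) ek)"
      unfolding \<open>b = (I, J)\<close> prod.case Let_def s_def[symmetric] N_def[symmetric] 1 2
      by simp
  qed
  also have "\<dots> = restrict EK_pairs (kappa (koszul polyvar (homotopy w)))"
    by (simp add: restrict_def kappa_eq_peel koszul_eq_peel peel_def homotopy_def lin_ext_lin_ext)
  finally show ?thesis .
qed


section \<open>The isomorphism\<close>

lemma linear_on_module_hom: "module_hom s1 s2 f \<Longrightarrow> linear_on S s1 s2 f"
  by (simp add: linear_on_def module_hom.add module_hom.scale)

lemma koszul_in_Lker: "v \<in> Lker a b \<Longrightarrow> koszul \<psi> v \<in> Lker (a - 1) b"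
  using koszul_kappa[of \<psi> v] by (auto simp: Lker_def simp del: One_nat_def intro: koszul_in_ext_sym_part)

lemma sym_power_koszul:
  fixes v :: "('n::{finite,linorder}, 'k::comm_ring_1) ext_sym"
  assumes "v \<in> Lker 1 d"
  shows "sym_power \<psi> (koszul \<psi> v) = 0"
proof -
  have "sym_power \<psi> (koszul \<psi> v) = lin_form (\<lambda>b. sym_power \<psi> (koszul \<psi> (Poly_Mapping.single b 1))) v"
    by (simp add: sym_power_def koszul_eq_peel peel_def lin_form_lin_ext)
  also have "\<dots> = lin_form (\<lambda>b. sym_power \<psi> (kappa (Poly_Mapping.single b 1))) v"
  proof (rule lin_form_cong)
    fix b assume "b \<in> Poly_Mapping.keys v"
    then have "card (fst b) = 1"
      using assms by (auto simp: Lker_def ext_sym_part_def dest: free_onD)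
    then obtain i M where "b = ({i}, M)" by (cases b) (auto simp: card_1_singleton_iff)
    then show "sym_power \<psi> (koszul \<psi> (Poly_Mapping.single b 1)) =
        sym_power \<psi> (kappa (Poly_Mapping.single b 1))"
      by (simp add: koszul_single kappa_single sym_power_def mult_ac)
  qed
  also have "\<dots> = sym_power \<psi> (kappa v)"
    by (simp add: sym_power_def kappa_eq_peel peel_def lin_form_lin_ext)
  also have "\<dots> = 0" using assms
    by (simp add: Lker_def sym_power_def lin_form_def)
  finally show ?thesis .
qed

lemma is_complex_L: "is_complex (L_complex d) (koszul \<psi>) (sym_power \<psi>)"
proof -
  have "free.subspace (Lker a d)" for a
    using subspace_free_on unfolding Lker_def ext_sym_part_def
    by (auto simp: free.subspace_def kappa.add kappa.scale)
  moreover have "koszul \<psi> v \<in> L_complex d (m - 1)" if "v \<in> L_complex d m" for m v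
    using koszul_in_Lker that unfolding L_complex_def by blast
  moreover have "linear_on S smul (*) (sym_power \<psi>)" for S
    unfolding sym_power_def by (intro linear_on_module_hom module_hom_lin_form)
  moreover have "linear_on S smul smul (koszul \<psi>)" for S
    by (intro linear_on_module_hom koszul.module_hom_axioms)
  ultimately show ?thesis
    unfolding is_complex_def using sym_power_koszul[of _ d \<psi>] by (auto simp: L_complex_def)
qed

lemma phi_in_L_complex:
  assumes "d \<ge> 1" "m \<ge> 1" "w \<in> EK_complex d m"
  shows "phi m w \<in> L_complex d m"
proof -
  have "kappa (homotopy w) \<in> ext_sym_part (m - 1) d"
    using kappa_in_ext_sym_part[OF homotopy_in_ext_sym_part[OF assms(3,1,2)]] assms(1) by simp
  then have "smul c (kappa (homotopy w)) \<in> ext_sym_part (m - 1) d" for c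
    unfolding ext_sym_part_def by (intro free.subspace_scale subspace_free_on)
  then show ?thesis
    unfolding phi_eq[OF assms(1,3)] L_complex_def Lker_def by (simp add: kappa.scale)
qed

lemma sign_involution: "smul ((-1) ^ k) (smul ((-1) ^ k) v) = v"
  by (simp flip: power_add)

lemma restrict_phi:
  assumes "d \<ge> 1" "w \<in> EK_complex d m"
  shows "smul ((-1) ^ (m - 1)) (restrict EK_pairs (phi m w)) = w"
proof -
  have "w \<in> free_on EK_pairs" using EK_complex_subset assms by blast
  then show ?thesis
    unfolding phi_eq[OF assms] restrict_smul sign_involution by (rule restrict_kappa_homotopy)
qed

lemma phi_restrict:
  assumes "d \<ge> 1" "v \<in> L_complex d m"
  shows "smul ((-1) ^ (m - 1)) (restrict EK_pairs v) \<in> EK_complex d m" (is "?w \<in> _")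
    and "phi m (smul ((-1) ^ (m - 1)) (restrict EK_pairs v)) = v"
proof -
  have v: "v \<in> ext_sym_part (m - 1) d" "kappa v = 0"
    using assms(2) by (auto simp: L_complex_def Lker_def)
  show w: "?w \<in> EK_complex d m"
    using restrict_in_EK_complex[OF v(1)] unfolding EK_complex_def
    by (intro free.subspace_scale subspace_free_on)
  have "v \<in> free_on {(A, M). M \<noteq> {#}}"
    using v(1) assms(1) by (fastforce simp: ext_sym_part_def free_on_def)
  from homotopy_identity[OF this] show "phi m ?w = v"
    unfolding phi_eq[OF assms(1) w] homotopy.scale kappa.scale sign_involution homotopy_restrict v(2)
    by simp
qed

lemma bij_betw_phi:
  assumes "d \<ge> 1" "m \<ge> 1"
  shows "bij_betw (phi m) (EK_complex d m) (L_complex d m)"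
  by (rule bij_betw_byWitness[where f' = "\<lambda>v. smul ((-1) ^ (m - 1)) (restrict EK_pairs v)"])
    (use assms phi_restrict restrict_phi phi_in_L_complex in auto)

lemma EK_diff_in_EK_complex:
  assumes "d \<ge> 1" "m \<ge> 2" "w \<in> EK_complex d m"
  shows "EK_diff w \<in> EK_complex d (m - 1)"
proof -
  have w: "w \<in> free_on EK_pairs" using EK_complex_subset assms by blast
  have "homotopy w \<in> ext_sym_part m (d - 1)"
    using assms by (intro homotopy_in_ext_sym_part) auto
  from kappa_in_ext_sym_part[OF koszul_in_ext_sym_part[OF this]]
  have "kappa (koszul polyvar (homotopy w)) \<in> ext_sym_part (m - 1 - 1) d"
    using assms(1) by simp
  then show ?thesis unfolding EK_diff_eq[OF w] by (rule restrict_in_EK_complex)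
qed

lemma koszul_phi:
  assumes "d \<ge> 1" "m \<ge> 2" "w \<in> EK_complex d m"
  shows "koszul polyvar (phi m w) = phi (m - 1) (EK_diff w)"
proof -
  have w: "w \<in> free_on EK_pairs" using EK_complex_subset assms by blast
  have "phi (m - 1) (EK_diff w) = smul ((-1) ^ (m - 1 - 1)) (kappa (koszul polyvar (homotopy w)))"
    unfolding phi_eq[OF assms(1) EK_diff_in_EK_complex[OF assms]]
    by (simp only: EK_diff_eq[OF w] homotopy_restrict kappa_homotopy_kappa)
  moreover obtain k where "m = Suc (Suc k)"
    using assms(2) by (metis add_2_eq_Suc le_Suc_ex)
  ultimately show ?thesis
    unfolding phi_eq[OF assms(1,3)] koszul.scale koszul_kappa by simp
qed

lemma sym_power_phi:
  fixes w :: "('n::{finite,linorder}, 'k::comm_ring_1) ek"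
  assumes "d \<ge> 1" "w \<in> EK_complex d 1"
  shows "sym_power polyvar (phi 1 w) = EK_aug w"
proof -
  have "sym_power polyvar (phi 1 w) =
      lin_form (\<lambda>b. sym_power polyvar (kappa (homotopy (Poly_Mapping.single b 1)))) w"
    unfolding phi_eq[OF assms]
    by (simp add: sym_power_def kappa_eq_peel peel_def homotopy_def lin_form_lin_ext lin_ext_lin_ext)
  also have "\<dots> = EK_aug w"
    unfolding EK_aug_def
  proof (rule lin_form_cong)
    fix b assume b: "b \<in> Poly_Mapping.keys w"
    have "card (fst b) = 0"
      using assms(2) b by (auto simp: EK_complex_def dest: free_onD)
    then obtain J where J: "b = ({}, J)" by (cases b) auto
    have E: "({}, J) \<in> EK_pairs"
      using EK_complex_subset[OF assms(1)] assms(2) b J by (auto dest: free_onD)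
    have pos: "pos {s} s = 0" for s :: 'n by (auto simp: pos_def)
    show "sym_power polyvar (kappa (homotopy (Poly_Mapping.single b 1))) =
        (case b of (I, J) \<Rightarrow> if I = {} then \<Prod>j\<in>#J. polyvar j else (0 :: ('n, 'k) polyring))"
      unfolding J homotopy_single[OF E] using EK_pairs_Max(1)[OF E]
      by (simp add: kappa_single sym_power_def pos)
  qed
  finally show ?thesis .
qed

lemma is_complex_EK:
  assumes "d \<ge> 1"
  shows "is_complex (EK_complex d) (EK_diff :: ('n::{finite,linorder}, 'k::comm_ring_1) ek \<Rightarrow> _) EK_aug"
proof -
  have "EK_diff (EK_diff v) = 0" if m: "m \<ge> 3" and v: "v \<in> EK_complex d m" for m and v :: "('n, 'k) ek"
  proof -
    have 1: "EK_diff v \<in> EK_complex d (m - 1)"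
      using m v assms by (intro EK_diff_in_EK_complex) auto
    have 2: "EK_diff (EK_diff v) \<in> EK_complex d (m - 1 - 1)"
      by (rule EK_diff_in_EK_complex[OF assms _ 1]) (use m in auto)
    have "phi (m - 1 - 1) (EK_diff (EK_diff v)) = koszul polyvar (phi (m - 1) (EK_diff v))"
      using m 1 assms by (intro koszul_phi[symmetric]) auto
    also have "phi (m - 1) (EK_diff v) = koszul polyvar (phi m v)"
      using m v assms by (intro koszul_phi[symmetric]) auto
    finally have "phi (m - 1 - 1) (EK_diff (EK_diff v)) = 0" by simp
    then show ?thesis
      using restrict_phi[OF assms 2] by (simp add: restrict_def)
  qed
  moreover have "EK_aug (EK_diff v) = 0" if v: "v \<in> EK_complex d 2" for v :: "('n, 'k) ek"
  proof -
    have 1: "EK_diff v \<in> EK_complex d 1"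
      using EK_diff_in_EK_complex[of d 2 v] v assms by simp
    have "phi 2 v \<in> Lker 1 d"
      using phi_in_L_complex[of d 2 v] v assms by (simp add: L_complex_def)
    then show ?thesis
      using sym_power_phi[OF assms 1] koszul_phi[of d 2 v] v assms
      by (simp flip: sym_power_koszul[of "phi 2 v" d polyvar])
  qed
  moreover have "linear_on S smul (*) EK_aug" for S :: "('n, 'k) ek set"
    unfolding EK_aug_def by (intro linear_on_module_hom module_hom_lin_form)
  moreover have "linear_on S smul smul EK_diff" for S :: "('n, 'k) ek set"
    unfolding EK_diff_def by (intro linear_on_module_hom module_hom_lin_ext)
  moreover have "free.subspace (EK_complex d m :: ('n, 'k) ek set)" for m
    unfolding EK_complex_def by (rule subspace_free_on)
  ultimately show ?thesis
    unfolding is_complex_def using EK_diff_in_EK_complex[OF assms] by auto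
qed

theorem proposition4p2:
  fixes d :: nat
  assumes "d \<ge> 1"
  shows "is_complex_iso
     (EK_complex d :: nat \<Rightarrow> ('n::{finite,linorder}, 'k::field) ek set) EK_diff EK_aug
     (L_complex d :: nat \<Rightarrow> ('n, 'k) ext_sym set) (koszul polyvar) (sym_power polyvar)
     id phi"
  unfolding is_complex_iso_def
proof (intro conjI allI impI ballI)
  show "linear_on UNIV (*) (*) (id :: ('n, 'k) polyring \<Rightarrow> _)" by (simp add: linear_on_def)
  show "linear_on (EK_complex d m) smul smul (phi m :: ('n, 'k) ek \<Rightarrow> ('n, 'k) ext_sym)" for m
    unfolding phi_def by (intro linear_on_module_hom module_hom_lin_ext)
qed (use assms is_complex_EK is_complex_L bij_betw_phi sym_power_phi koszul_phi in auto)

end
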